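(* Let $G$ be a group and let $\Gamma={\rm Cay}(G,G\setminus\{1_G\})$ be the complete graph viewed as a Cayley graph on $G$. Then $\Gamma$ is a CCA graph if and only if $G$ is not a Hamiltonian $2$-group.
   Context: For a group $G$ and $S\subseteq G$ with $1_G\notin S$ and $S=S^{-1}$, the Cayley graph ${\rm Cay}(G,S)$ has vertex set $G$ and edges $\{g,gs\}$ for $g\in G$, $s\in S$. Each edge $\{g,gs\}$ is colored by the color $c(s)$, where $c(s)=c(s')$ iff $s'\in\{s,s^{-1}\}$. An automorphism is color-preserving if it maps each color class of edges onto itself. A permutation of $G$ is affine if it has the form $x\mapsto k\varphi(x)$ with $k\in G$, $\varphi\in{\rm Aut}(G)$. ${\rm Cay}(G,S)$ is a CCA graph if every color-preserving automorphism of it is affine. A Hamiltonian $2$-group is a nonabelian $2$-group all of whose subgroups are normal; equivalently (finite case) a group of the form $Q_8\times{\mathbb Z}_2^n$, $n\ge 0$. All groups are finite. *)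

theory Defs
  imports "HOL-Algebra.Algebra"
begin

text \<open>A simple graph is given by its vertex set and its set of edges, each edge being a
  two-element set of vertices. Permutations of the vertex set are functions whose values
  outside that set are irrelevant; every notion below looks at them on the vertex set only.\<close>

definition graph_automorphism :: "'a set \<Rightarrow> 'a set set \<Rightarrow> ('a \<Rightarrow> 'a) \<Rightarrow> bool" where
  "graph_automorphism V E \<alpha> \<longleftrightarrow>
     bij_betw \<alpha> V V \<and> (\<forall>u\<in>V. \<forall>v\<in>V. {\<alpha> u, \<alpha> v} \<in> E \<longleftrightarrow> {u, v} \<in> E)"

definition cayley_connection_set :: "('a, 'b) monoid_scheme \<Rightarrow> 'a set \<Rightarrow> bool" where
  "cayley_connection_set G S \<longleftrightarrow>
     S \<subseteq> carrier G \<and> \<one>\<^bsub>G\<^esub> \<notin> S \<and> S = (\<lambda>s. inv\<^bsub>G\<^esub> s) ` S"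

definition cayley_edges :: "('a, 'b) monoid_scheme \<Rightarrow> 'a set \<Rightarrow> 'a set set" where
  "cayley_edges G S = {{g, g \<otimes>\<^bsub>G\<^esub> s} | g s. g \<in> carrier G \<and> s \<in> S}"

text \<open>The colors are the sets \<open>{s, s\<inverse>}\<close>. That the color of an edge does not depend on the way
  it is written as \<open>{g, g s}\<close> is shown in \<open>cayley_color_well_defined\<close>.\<close>

definition cayley_color :: "('a, 'b) monoid_scheme \<Rightarrow> 'a \<Rightarrow> 'a set" where
  "cayley_color G s = {s, inv\<^bsub>G\<^esub> s}"

definition cayley_color_class ::
    "('a, 'b) monoid_scheme \<Rightarrow> 'a set \<Rightarrow> 'a set \<Rightarrow> 'a set set" where
  "cayley_color_class G S c =
     {{g, g \<otimes>\<^bsub>G\<^esub> s} | g s. g \<in> carrier G \<and> s \<in> S \<and> cayley_color G s = c}"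

definition color_preserving_automorphism ::
    "('a, 'b) monoid_scheme \<Rightarrow> 'a set \<Rightarrow> ('a \<Rightarrow> 'a) \<Rightarrow> bool" where
  "color_preserving_automorphism G S \<alpha> \<longleftrightarrow>
     graph_automorphism (carrier G) (cayley_edges G S) \<alpha> \<and>
     (\<forall>s\<in>S. (\<lambda>e. \<alpha> ` e) ` cayley_color_class G S (cayley_color G s)
             = cayley_color_class G S (cayley_color G s))"

definition affine_permutation :: "('a, 'b) monoid_scheme \<Rightarrow> ('a \<Rightarrow> 'a) \<Rightarrow> bool" where
  "affine_permutation G \<alpha> \<longleftrightarrow>
     (\<exists>k\<in>carrier G. \<exists>\<phi>\<in>iso G G. \<forall>x\<in>carrier G. \<alpha> x = k \<otimes>\<^bsub>G\<^esub> \<phi> x)"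

text \<open>Meaningful when \<open>cayley_connection_set G S\<close> holds.\<close>

definition CCA_graph :: "('a, 'b) monoid_scheme \<Rightarrow> 'a set \<Rightarrow> bool" where
  "CCA_graph G S \<longleftrightarrow>
     (\<forall>\<alpha>. color_preserving_automorphism G S \<alpha> \<longrightarrow> affine_permutation G \<alpha>)"

text \<open>In a \<open>2\<close>-group every element has order a power of \<open>2\<close>; for finite groups this says that
  the order of the group is a power of \<open>2\<close>. An element of infinite order has
  \<open>group.ord G x = 0\<close>, which is not a power of \<open>2\<close>.\<close>

definition two_group :: "('a, 'b) monoid_scheme \<Rightarrow> bool" where
  "two_group G \<longleftrightarrow> group G \<and> (\<forall>x\<in>carrier G. \<exists>n::nat. group.ord G x = 2 ^ n)"

definition hamiltonian_two_group :: "('a, 'b) monoid_scheme \<Rightarrow> bool" where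
  "hamiltonian_two_group G \<longleftrightarrow>
     two_group G \<and> \<not> comm_group G \<and> (\<forall>H. subgroup H G \<longrightarrow> H \<lhd> G)"

lemma cayley_color_eq_iff:
  assumes "group G" "s \<in> carrier G" "s' \<in> carrier G"
  shows "cayley_color G s = cayley_color G s' \<longleftrightarrow> s' \<in> {s, inv\<^bsub>G\<^esub> s}"
proof -
  interpret group G by fact
  show ?thesis
    unfolding cayley_color_def doubleton_eq_iff using assms by (metis inv_inv insert_iff singletonD)
qed

lemma cayley_color_well_defined:
  assumes "group G" "g \<in> carrier G" "s \<in> carrier G" "h \<in> carrier G" "t \<in> carrier G"
    and eq: "{g, g \<otimes>\<^bsub>G\<^esub> s} = {h, h \<otimes>\<^bsub>G\<^esub> t}"
  shows "cayley_color G s = cayley_color G t"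
proof -
  interpret group G by fact
  have "t = s \<or> t = inv\<^bsub>G\<^esub> s"
    using eq unfolding doubleton_eq_iff
  proof
    assume "g = h \<and> g \<otimes>\<^bsub>G\<^esub> s = h \<otimes>\<^bsub>G\<^esub> t"
    then show ?thesis using assms by (metis l_cancel)
  next
    assume *: "g = h \<otimes>\<^bsub>G\<^esub> t \<and> g \<otimes>\<^bsub>G\<^esub> s = h"
    then have "h \<otimes>\<^bsub>G\<^esub> (t \<otimes>\<^bsub>G\<^esub> s) = h"
      using assms(2-5) m_assoc by metis
    then have "t \<otimes>\<^bsub>G\<^esub> s = \<one>\<^bsub>G\<^esub>"
      using assms(2-5) by simp
    then have "inv\<^bsub>G\<^esub> s = t"
      by (rule inv_equality) (use assms(3,5) in auto)
    then show ?thesis by simp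
  qed
  then show ?thesis
    using cayley_color_eq_iff[OF assms(1,3,5)] by simp
qed

lemma cayley_connection_set_complete:
  assumes "group G"
  shows "cayley_connection_set G (carrier G - {\<one>\<^bsub>G\<^esub>})"
proof -
  interpret group G by fact
  have "x \<in> (\<lambda>s. inv\<^bsub>G\<^esub> s) ` (carrier G - {\<one>\<^bsub>G\<^esub>})" if "x \<in> carrier G - {\<one>\<^bsub>G\<^esub>}" for x
    by (rule image_eqI[of _ _ "inv\<^bsub>G\<^esub> x"]) (use that in auto)
  then show ?thesis
    unfolding cayley_connection_set_def by auto
qed

lemma cayley_edges_complete:
  assumes "group G"
  shows "cayley_edges G (carrier G - {\<one>\<^bsub>G\<^esub>})
         = {{u, v} | u v. u \<in> carrier G \<and> v \<in> carrier G \<and> u \<noteq> v}"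
proof -
  interpret group G by fact
  have 1: "g \<noteq> g \<otimes>\<^bsub>G\<^esub> s" if "g \<in> carrier G" "s \<in> carrier G" "s \<noteq> \<one>\<^bsub>G\<^esub>" for g s
    using that by simp
  have 2: "\<exists>s\<in>carrier G - {\<one>\<^bsub>G\<^esub>}. v = u \<otimes>\<^bsub>G\<^esub> s"
    if "u \<in> carrier G" "v \<in> carrier G" "u \<noteq> v" for u v
    by (rule bexI[of _ "inv\<^bsub>G\<^esub> u \<otimes>\<^bsub>G\<^esub> v"])
       (use that in \<open>simp_all add: inv_solve_left' inv_comm flip: m_assoc\<close>)
  show ?thesis
  proof (intro equalityI subsetI)
    fix e assume "e \<in> cayley_edges G (carrier G - {\<one>\<^bsub>G\<^esub>})"
    then obtain g s where "e = {g, g \<otimes>\<^bsub>G\<^esub> s}" "g \<in> carrier G" "s \<in> carrier G" "s \<noteq> \<one>\<^bsub>G\<^esub>"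
      unfolding cayley_edges_def by blast
    then show "e \<in> {{u, v} | u v. u \<in> carrier G \<and> v \<in> carrier G \<and> u \<noteq> v}"
      using 1 m_closed by blast
  next
    fix e assume "e \<in> {{u, v} | u v. u \<in> carrier G \<and> v \<in> carrier G \<and> u \<noteq> v}"
    then show "e \<in> cayley_edges G (carrier G - {\<one>\<^bsub>G\<^esub>})"
      unfolding cayley_edges_def using 2 by blast
  qed
qed

end

theory Submission
  imports Defs
begin

text \<open>Every edge \<open>{x, y}\<close> being present, a color-preserving automorphism is a bijection \<open>\<alpha>\<close> with
  \<open>\<alpha>(x)\<inverse> \<alpha>(y) \<in> {x\<inverse> y, y\<inverse> x}\<close> for all \<open>x\<close>, \<open>y\<close>. Suppose \<open>\<alpha> \<one> = \<one>\<close>; then each element is fixed or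
  inverted. Let \<open>F\<close> be the set of fixed elements and \<open>B\<close> its complement. Each \<open>b \<in> B\<close> inverts every
  \<open>f \<in> F\<close> under conjugation. If \<open>F\<close> is closed under multiplication and does not consist of
  involutions, it is an abelian subgroup of index at most \<open>2\<close> and \<open>\<alpha>\<close> is a homomorphism. If \<open>x y \<in> B\<close>
  with \<open>x, y \<in> F\<close>, then \<open>\<alpha>\<close> is inversion followed by conjugation by \<open>(x y)\<inverse>\<close>. So when \<open>\<alpha>\<close> is no homomorphism,
  inversion itself preserves colors and \<open>G\<close> is nonabelian; then noncommuting elements have
  equal squares and invert each other, whence \<open>G\<close> is a Hamiltonian \<open>2\<close>-group.

  Conversely, in a Hamiltonian \<open>2\<close>-group a noncommuting pair with minimal sum of orders generates a
  quaternion group \<open>Q\<close> of order \<open>8\<close>, and \<open>G = Q C(Q)\<close> where \<open>C(Q)\<close> has exponent dividing \<open>4\<close>. So \<open>G\<close> has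
  exponent \<open>4\<close>, every conjugate of \<open>g\<close> is \<open>g\<close> or \<open>g\<inverse>\<close>, and inversion preserves colors although it
  is not affine, \<open>G\<close> being nonabelian.\<close>

section \<open>Color preservation as a condition on quotients\<close>

definition preserves_colors :: "('a, 'b) monoid_scheme \<Rightarrow> ('a \<Rightarrow> 'a) \<Rightarrow> bool" where
  "preserves_colors G \<alpha> \<longleftrightarrow>
     (\<forall>x\<in>carrier G. \<forall>y\<in>carrier G.
        inv\<^bsub>G\<^esub> (\<alpha> x) \<otimes>\<^bsub>G\<^esub> \<alpha> y \<in> {inv\<^bsub>G\<^esub> x \<otimes>\<^bsub>G\<^esub> y, inv\<^bsub>G\<^esub> y \<otimes>\<^bsub>G\<^esub> x})"

context group
begin

lemma inv_mult_cancel [simp]: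
  assumes "x \<in> carrier G" "y \<in> carrier G"
  shows "inv x \<otimes> (x \<otimes> y) = y" "x \<otimes> (inv x \<otimes> y) = y"
  using assms by (simp_all flip: m_assoc)

lemma cayley_color_diff:
  assumes "x \<in> carrier G" "y \<in> carrier G"
  shows "cayley_color G (inv x \<otimes> y) = {inv x \<otimes> y, inv y \<otimes> x}"
  using assms by (simp add: cayley_color_def inv_mult_group)

text \<open>The substitution \<open>s = inv x \<otimes> y\<close> replaces the base point and
  generator of an edge by its two endpoints, and \<open>s \<noteq> \<one>\<close> becomes
  \<open>x \<noteq> y\<close>.\<close>

lemma cayley_color_class_complete:
  "cayley_color_class G (carrier G - {\<one>}) c =
    {{x, y} | x y. x \<in> carrier G \<and> y \<in> carrier G \<and> x \<noteq> y \<and> cayley_color G (inv x \<otimes> y) = c}"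
proof (intro equalityI subsetI)
  fix e assume "e \<in> cayley_color_class G (carrier G - {\<one>}) c"
  then obtain g s where "e = {g, g \<otimes> s}" "g \<in> carrier G" "s \<in> carrier G" "s \<noteq> \<one>"
    "cayley_color G s = c"
    unfolding cayley_color_class_def by blast
  moreover from this have "g \<noteq> g \<otimes> s" by simp
  ultimately show "e \<in> {{x, y} | x y. x \<in> carrier G \<and> y \<in> carrier G \<and> x \<noteq> y \<and>
      cayley_color G (inv x \<otimes> y) = c}"
    by (intro CollectI exI[of _ g] exI[of _ "g \<otimes> s"]) simp
next
  fix e assume "e \<in> {{x, y} | x y. x \<in> carrier G \<and> y \<in> carrier G \<and> x \<noteq> y \<and>
      cayley_color G (inv x \<otimes> y) = c}"
  then obtain x y where *: "e = {x, y}" "x \<in> carrier G" "y \<in> carrier G" "x \<noteq> y"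
    "cayley_color G (inv x \<otimes> y) = c" by blast
  moreover from this have "inv x \<otimes> y \<noteq> \<one>"
    by (metis inv_equality inv_closed inv_inv)
  ultimately show "e \<in> cayley_color_class G (carrier G - {\<one>}) c"
    unfolding cayley_color_class_def
    by (intro CollectI exI[of _ x] exI[of _ "inv x \<otimes> y"]) simp
qed

text \<open>The color of the edge \<open>{x, y}\<close> consists of its two quotients. Conversely,
  quotients kept up to inversion give equal colors, so each class is mapped into itself, and
  surjectivity of \<alpha> lifts every edge of a class to one of the same class.\<close>

lemma color_preserving_automorphism_complete_iff:
  "color_preserving_automorphism G (carrier G - {\<one>}) \<alpha> \<longleftrightarrow>
    bij_betw \<alpha> (carrier G) (carrier G) \<and> preserves_colors G \<alpha>"
proof (intro iffI conjI)
  assume *: "color_preserving_automorphism G (carrier G - {\<one>}) \<alpha>"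
  then show bij: "bij_betw \<alpha> (carrier G) (carrier G)"
    unfolding color_preserving_automorphism_def graph_automorphism_def by blast
  have "inv (\<alpha> x) \<otimes> \<alpha> y \<in> {inv x \<otimes> y, inv y \<otimes> x}"
    if xy: "x \<in> carrier G" "y \<in> carrier G" for x y
  proof (cases "x = y")
    case True
    then show ?thesis using xy bij by (simp add: bij_betwE)
  next
    case False
    let ?s = "inv x \<otimes> y"
    have \<alpha>xy: "\<alpha> x \<in> carrier G" "\<alpha> y \<in> carrier G"
      using bij xy by (simp_all add: bij_betwE)
    have s: "?s \<in> carrier G - {\<one>}"
      using xy False by (metis DiffI inv_equality inv_closed inv_inv m_closed singletonD)
    have "{x, y} \<in> cayley_color_class G (carrier G - {\<one>}) (cayley_color G ?s)"
      unfolding cayley_color_class_complete using xy False by blast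
    then have "\<alpha> ` {x, y} \<in> cayley_color_class G (carrier G - {\<one>}) (cayley_color G ?s)"
      using * s unfolding color_preserving_automorphism_def by blast
    then obtain u v where uv: "{\<alpha> x, \<alpha> y} = {u, v}" "u \<in> carrier G" "v \<in> carrier G"
      "cayley_color G (inv u \<otimes> v) = cayley_color G ?s"
      unfolding cayley_color_class_complete by auto
    \<comment> \<open>The endpoints \<open>u\<close>, \<open>v\<close> may come in either order,
      which is harmless because a color contains both quotients.\<close>
    have "inv (\<alpha> x) \<otimes> \<alpha> y \<in> cayley_color G (inv u \<otimes> v)"
      using uv(1) cayley_color_diff[OF uv(2,3)] unfolding doubleton_eq_iff by auto
    then show ?thesis
      using uv(4) cayley_color_diff[OF xy] by simp
  qed
  then show "preserves_colors G \<alpha>"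
    unfolding preserves_colors_def by blast
next
  assume *: "bij_betw \<alpha> (carrier G) (carrier G) \<and> preserves_colors G \<alpha>"
  then have bij: "bij_betw \<alpha> (carrier G) (carrier G)" by blast
  have color: "cayley_color G (inv (\<alpha> x) \<otimes> \<alpha> y) = cayley_color G (inv x \<otimes> y)"
    if xy: "x \<in> carrier G" "y \<in> carrier G" for x y
  proof -
    have "inv (\<alpha> x) \<otimes> \<alpha> y \<in> cayley_color G (inv x \<otimes> y)"
      using * xy cayley_color_diff[OF xy] unfolding preserves_colors_def by blast
    then show ?thesis
      using xy bij by (subst eq_commute, subst cayley_color_eq_iff)
        (auto simp: bij_betwE cayley_color_def is_group)
  qed
  have inj: "\<alpha> x = \<alpha> y \<longleftrightarrow> x = y" if "x \<in> carrier G" "y \<in> carrier G" for x y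
    using bij that by (auto simp: bij_betw_def inj_on_def)
  have onto: "\<exists>x\<in>carrier G. \<alpha> x = u" if "u \<in> carrier G" for u
    using bij that by (force simp: bij_betw_def)
  have "{\<alpha> u, \<alpha> v} \<in> cayley_edges G (carrier G - {\<one>}) \<longleftrightarrow> {u, v} \<in> cayley_edges G (carrier G - {\<one>})"
    if "u \<in> carrier G" "v \<in> carrier G" for u v
  proof -
    have "{u, v} \<in> {{u, v} | u v. u \<in> carrier G \<and> v \<in> carrier G \<and> u \<noteq> v} \<longleftrightarrow> u \<noteq> v"
      if "u \<in> carrier G" "v \<in> carrier G" for u v
      using that by (auto simp: doubleton_eq_iff)
    then show ?thesis
      unfolding cayley_edges_complete[OF is_group] using that bij inj by (simp add: bij_betwE)
  qed
  moreover have "(\<lambda>e. \<alpha> ` e) ` cayley_color_class G (carrier G - {\<one>}) c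
      = cayley_color_class G (carrier G - {\<one>}) c" for c
  proof (intro equalityI subsetI)
    fix e assume "e \<in> (\<lambda>e. \<alpha> ` e) ` cayley_color_class G (carrier G - {\<one>}) c"
    then obtain x y where xy: "e = {\<alpha> x, \<alpha> y}" "x \<in> carrier G" "y \<in> carrier G" "x \<noteq> y"
      "cayley_color G (inv x \<otimes> y) = c"
      unfolding cayley_color_class_complete by auto
    then show "e \<in> cayley_color_class G (carrier G - {\<one>}) c"
      unfolding cayley_color_class_complete using color inj bij
      by (intro CollectI exI[of _ "\<alpha> x"] exI[of _ "\<alpha> y"]) (simp add: bij_betwE)
  next
    fix e assume "e \<in> cayley_color_class G (carrier G - {\<one>}) c"
    then obtain u v where "e = {u, v}" "u \<in> carrier G" "v \<in> carrier G" "u \<noteq> v"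
      "cayley_color G (inv u \<otimes> v) = c"
      unfolding cayley_color_class_complete by auto
    moreover from this onto obtain x y where "x \<in> carrier G" "\<alpha> x = u" "y \<in> carrier G" "\<alpha> y = v"
      by blast
    ultimately have "e = \<alpha> ` {x, y}" "x \<in> carrier G" "y \<in> carrier G" "x \<noteq> y"
      "cayley_color G (inv x \<otimes> y) = c"
      using color by auto
    then have "e = \<alpha> ` {x, y}" "{x, y} \<in> cayley_color_class G (carrier G - {\<one>}) c"
      unfolding cayley_color_class_complete by blast+
    then show "e \<in> (\<lambda>e. \<alpha> ` e) ` cayley_color_class G (carrier G - {\<one>}) c" by blast
  qed
  ultimately show "color_preserving_automorphism G (carrier G - {\<one>}) \<alpha>"
    unfolding color_preserving_automorphism_def graph_automorphism_def using bij by blast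
qed

section \<open>Groups in which inversion preserves colors\<close>

text \<open>Inversion turns the quotient of \<open>x\<close> and \<open>y\<close> into
  \<open>x \<otimes> inv y\<close>. Equality with \<open>inv y \<otimes> x\<close> would make them
  commute, and equality with \<open>inv x \<otimes> y\<close> says that the squares agree.\<close>

lemma square_eq_if_not_commute:
  assumes "preserves_colors G (\<lambda>x. inv x)" "x \<in> carrier G" "y \<in> carrier G"
    "x \<otimes> y \<noteq> y \<otimes> x"
  shows "x \<otimes> x = y \<otimes> y"
proof -
  have "x \<otimes> inv y \<in> {inv x \<otimes> y, inv y \<otimes> x}"
    using assms(1-3) unfolding preserves_colors_def by force
  moreover have False if "x \<otimes> inv y = inv y \<otimes> x"
  proof -
    have "y \<otimes> (x \<otimes> inv y) \<otimes> y = y \<otimes> (inv y \<otimes> x) \<otimes> y" using that by simp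
    then show False using assms(2-4) by (simp add: m_assoc)
  qed
  ultimately have "x \<otimes> (x \<otimes> inv y) \<otimes> y = x \<otimes> (inv x \<otimes> y) \<otimes> y" by auto
  then show ?thesis
    using assms(2,3) by (simp add: m_assoc)
qed

text \<open>The elements \<open>y \<otimes> x\<close> and \<open>x\<close> do not commute either, so
  their squares agree; cancelling \<open>x\<close> leaves
  \<open>y \<otimes> x \<otimes> y = x\<close>.\<close>

lemma conj_eq_inv_if_not_commute:
  assumes "preserves_colors G (\<lambda>x. inv x)" "x \<in> carrier G" "y \<in> carrier G"
    "x \<otimes> y \<noteq> y \<otimes> x"
  shows "x \<otimes> y \<otimes> inv x = inv y"
proof -
  have "(y \<otimes> x) \<otimes> x \<noteq> (x \<otimes> y) \<otimes> x"
    using assms(2-4) by simp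
  then have "(y \<otimes> x) \<otimes> (y \<otimes> x) = x \<otimes> x"
    using square_eq_if_not_commute[OF assms(1), of "y \<otimes> x" x] assms(2,3) by (simp add: m_assoc)
  then have "(y \<otimes> x \<otimes> y) \<otimes> x = x \<otimes> x"
    using assms(2,3) by (simp add: m_assoc)
  then have "y \<otimes> x \<otimes> y = x"
    using assms(2,3) by simp
  then have "inv y \<otimes> (y \<otimes> x \<otimes> y) \<otimes> inv x = inv y \<otimes> x \<otimes> inv x" by simp
  then show ?thesis
    using assms(2,3) by (simp add: m_assoc)
qed

lemma pow_numeral_eq:
  assumes "x \<in> carrier G"
  shows "x [^] (2::nat) = x \<otimes> x" "x [^] (4::nat) = x \<otimes> x \<otimes> (x \<otimes> x)"
  using assms by (simp_all add: numeral_eq_Suc m_assoc)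

lemma hamiltonian_two_group_if_inv_preserves_colors:
  assumes pres: "preserves_colors G (\<lambda>x. inv x)" and "\<not> comm_group G"
  shows "hamiltonian_two_group G"
proof -
  obtain a b where ab: "a \<in> carrier G" "b \<in> carrier G" "a \<otimes> b \<noteq> b \<otimes> a"
    using assms(2) group_comm_groupI by blast
  \<comment> \<open>The square of \<open>x\<close> equals that of \<open>y\<close> and so commutes
    with \<open>y\<close>, while conjugation by \<open>y\<close> inverts it; hence it is its own
    inverse.\<close>
  have pow4: "x \<otimes> x \<otimes> (x \<otimes> x) = \<one>"
    if x: "x \<in> carrier G" and y: "y \<in> carrier G" and "x \<otimes> y \<noteq> y \<otimes> x" for x y
  proof -
    have c: "y \<otimes> x \<otimes> inv y = inv x"
      using conj_eq_inv_if_not_commute[OF pres y x] that by metis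
    have "y \<otimes> (x \<otimes> x) \<otimes> inv y = (y \<otimes> x \<otimes> inv y) \<otimes> (y \<otimes> x \<otimes> inv y)"
      using x y by (simp add: m_assoc)
    also have "\<dots> = inv (x \<otimes> x)" using c x by (simp add: inv_mult_group)
    finally have "inv (x \<otimes> x) = y \<otimes> (y \<otimes> y) \<otimes> inv y"
      using square_eq_if_not_commute[OF pres x y] that by simp
    also have "\<dots> = x \<otimes> x"
      using square_eq_if_not_commute[OF pres x y] that by (simp add: m_assoc)
    finally show ?thesis
      using x by (metis l_inv m_closed)
  qed
  have "x [^] (4::nat) = \<one>" if x: "x \<in> carrier G" for x
  proof (cases "\<exists>y\<in>carrier G. x \<otimes> y \<noteq> y \<otimes> x")
    case True
    then show ?thesis using pow4 x by (auto simp: pow_numeral_eq)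
  next
    case False
    then have x_comm: "x \<otimes> y = y \<otimes> x" if "y \<in> carrier G" for y using that by blast
    \<comment> \<open>A central \<open>x\<close> is reached through \<open>a \<otimes> x\<close>,
      which fails to commute with \<open>b\<close> just as \<open>a\<close> does. Then
      \<open>a \<otimes> x\<close> and \<open>a\<close> have the same square, so
      \<open>x \<otimes> x = \<one>\<close>.\<close>
    have "(a \<otimes> x) \<otimes> b \<noteq> b \<otimes> (a \<otimes> x)"
      using ab x x_comm[OF ab(2)] by (simp add: m_assoc) (simp flip: m_assoc)
    then have "(a \<otimes> x) \<otimes> (a \<otimes> x) = b \<otimes> b"
      using square_eq_if_not_commute[OF pres] ab x by (meson m_closed)
    also have "\<dots> = a \<otimes> a"
      using square_eq_if_not_commute[OF pres ab(1,2)] ab(3) by simp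
    also have "(a \<otimes> x) \<otimes> (a \<otimes> x) = a \<otimes> a \<otimes> (x \<otimes> x)"
    proof -
      have "(a \<otimes> x) \<otimes> (a \<otimes> x) = a \<otimes> (x \<otimes> a) \<otimes> x" using ab x by (simp add: m_assoc)
      also have "\<dots> = a \<otimes> a \<otimes> (x \<otimes> x)"
        unfolding x_comm[OF ab(1)] using ab x by (simp add: m_assoc)
      finally show ?thesis .
    qed
    finally show ?thesis
      using ab x by (simp add: pow_numeral_eq)
  qed
  then have "ord x dvd 2 ^ 2" if "x \<in> carrier G" for x
    using that pow_eq_id[of x 4] by simp
  then have "\<exists>n::nat. ord x = 2 ^ n" if "x \<in> carrier G" for x
    using that divides_primepow_nat[OF two_is_prime_nat] by blast
  then have "two_group G"
    unfolding two_group_def by (simp add: is_group)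
  moreover have "H \<lhd> G" if H: "subgroup H G" for H
  proof (rule normal_inv_iff[THEN iffD2], intro conjI H ballI)
    fix x h assume xh: "x \<in> carrier G" "h \<in> H"
    then have h: "h \<in> carrier G" by (simp add: subgroup.mem_carrier[OF H])
    show "x \<otimes> h \<otimes> inv x \<in> H"
    proof (cases "x \<otimes> h = h \<otimes> x")
      case True
      then show ?thesis using xh h by (simp add: m_assoc)
    next
      case False
      then show ?thesis
        using conj_eq_inv_if_not_commute[OF pres xh(1) h] subgroup.m_inv_closed[OF H] xh by simp
    qed
  qed
  ultimately show ?thesis
    unfolding hamiltonian_two_group_def using assms(2) by blast
qed

section \<open>Color-preserving maps that are not homomorphisms\<close>

text \<open>If the fixed set \<open>F\<close> has only elements of square \<open>\<one>\<close>,
  then \<alpha> is inversion. If \<open>F\<close> is closed and has another element, \<alpha> is a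
  homomorphism. What remains is a product of two fixed elements that is not fixed.\<close>

lemma preserves_colors_inv_if_not_hom:
  assumes pres: "preserves_colors G \<alpha>" and \<alpha>: "\<alpha> \<in> carrier G \<rightarrow> carrier G" and one: "\<alpha> \<one> = \<one>"
    and not_hom: "\<alpha> \<notin> hom G G"
  shows "preserves_colors G (\<lambda>x. inv x)" "\<not> comm_group G"
proof -
  have diff: "inv (\<alpha> x) \<otimes> \<alpha> y \<in> {inv x \<otimes> y, inv y \<otimes> x}"
    if "x \<in> carrier G" "y \<in> carrier G" for x y
    using pres that unfolding preserves_colors_def by blast
  have \<alpha>_or: "\<alpha> x = x \<or> \<alpha> x = inv x" if "x \<in> carrier G" for x
    using diff[of \<one> x] that one \<alpha> by (auto simp: Pi_iff)
  define F where "F = {x \<in> carrier G. \<alpha> x = x}"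
  \<comment> \<open>Elements of square \<open>\<one>\<close> are counted in \<open>F\<close>, so
    \<open>B\<close> holds only elements that \<alpha> really moves and is disjoint from
    \<open>F\<close>.\<close>
  define B where "B = {x \<in> carrier G. \<alpha> x = inv x \<and> inv x \<noteq> x}"
  have FB: "x \<in> F \<or> x \<in> B" if "x \<in> carrier G" for x
    using \<alpha>_or that unfolding F_def B_def by force
  have F: "x \<in> carrier G" "\<alpha> x = x" if "x \<in> F" for x using that by (auto simp: F_def)
  have B: "x \<in> carrier G" "\<alpha> x = inv x" "inv x \<noteq> x" if "x \<in> B" for x using that by (auto simp: B_def)
  \<comment> \<open>The quotient of \<open>f\<close> and \<open>b\<close> is sent to
    \<open>inv f \<otimes> inv b\<close>. It cannot equal \<open>inv f \<otimes> b\<close>, because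
    \<open>b\<close> is not its own inverse, so it is \<open>inv b \<otimes> f\<close>.\<close>
  have swap: "f \<otimes> b = b \<otimes> inv f" if f: "f \<in> F" and b: "b \<in> B" for f b
  proof -
    have "inv f \<otimes> inv b \<noteq> inv f \<otimes> b"
      using F[OF f] B[OF b] by simp
    then have "inv f \<otimes> inv b = inv b \<otimes> f"
      using diff[of f b] F[OF f] B[OF b] by auto
    then have "b \<otimes> (inv f \<otimes> inv b) \<otimes> b = b \<otimes> (inv b \<otimes> f) \<otimes> b" by simp
    then show ?thesis using F[OF f] B[OF b] by (simp add: m_assoc)
  qed
  have swap': "inv f \<otimes> b = b \<otimes> f" if f: "f \<in> F" and b: "b \<in> B" for f b
  proof -
    have "inv f \<otimes> (f \<otimes> b) \<otimes> f = inv f \<otimes> (b \<otimes> inv f) \<otimes> f"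
      using swap[OF f b] by simp
    then show ?thesis using F[OF f] B[OF b] by (simp add: m_assoc)
  qed
  have closed_hom: "\<alpha> \<in> hom G G"
    if F_closed: "\<And>x y. x \<in> F \<Longrightarrow> y \<in> F \<Longrightarrow> x \<otimes> y \<in> F" and a: "a \<in> F" "inv a \<noteq> a" for a
  proof -
    have inv_F: "inv f \<in> F" if f: "f \<in> F" for f
    proof (rule ccontr)
      assume "inv f \<notin> F"
      then have "inv f \<in> B" using FB F[OF f] by blast
      moreover from swap[OF f this] have "inv f \<otimes> inv f = \<one>" using F[OF f] by simp
      then have "inv (inv f) = inv f" using F[OF f] by (intro inv_equality) simp_all
      ultimately show False using B(3)[of "inv f"] by metis
    qed
    have FB_B: "f \<otimes> b \<in> B" "b \<otimes> f \<in> B" if f: "f \<in> F" and b: "b \<in> B" for f b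
    proof -
      have "b \<notin> F" using B(2,3)[OF b] F(2)[of b] by auto
      have "f \<otimes> b \<notin> F"
        using F_closed[OF inv_F[OF f], of "f \<otimes> b"] F[OF f] B[OF b] \<open>b \<notin> F\<close> by auto
      then show "f \<otimes> b \<in> B" using FB F(1)[OF f] B(1)[OF b] by blast
      have "b \<otimes> f \<notin> F"
        using F_closed[OF _ inv_F[OF f], of "b \<otimes> f"] F[OF f] B[OF b] \<open>b \<notin> F\<close> by (auto simp: m_assoc)
      then show "b \<otimes> f \<in> B" using FB F(1)[OF f] B(1)[OF b] by blast
    qed
    \<comment> \<open>Conjugation by \<open>b\<close> and by \<open>b'\<close> each inverts
      \<open>a\<close>, so the product commutes with \<open>a\<close>. Lying in \<open>B\<close> it
      would also invert \<open>a\<close>, contrary to \<open>inv a \<noteq> a\<close>.\<close>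
    have BB_F: "b \<otimes> b' \<in> F" if b: "b \<in> B" and b': "b' \<in> B" for b b'
    proof (rule ccontr)
      assume "b \<otimes> b' \<notin> F"
      then have bb': "b \<otimes> b' \<in> B" using FB B(1) b b' by blast
      have "(b \<otimes> b') \<otimes> inv a = a \<otimes> (b \<otimes> b')" using swap[OF a(1) bb'] by simp
      also have "\<dots> = (a \<otimes> b) \<otimes> b'" using F[OF a(1)] B[OF b] B[OF b'] by (simp add: m_assoc)
      also have "\<dots> = b \<otimes> (inv a \<otimes> b')"
        unfolding swap[OF a(1) b] using F[OF a(1)] B[OF b] B[OF b'] by (simp add: m_assoc)
      also have "\<dots> = (b \<otimes> b') \<otimes> a"
        unfolding swap'[OF a(1) b'] using F[OF a(1)] B[OF b] B[OF b'] by (simp add: m_assoc)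
      finally show False using a F[OF a(1)] B[OF b] B[OF b'] by simp
    qed
    have "\<alpha> (x \<otimes> y) = \<alpha> x \<otimes> \<alpha> y" if xy: "x \<in> carrier G" "y \<in> carrier G" for x y
    proof -
      consider "x \<in> F" "y \<in> F" | "x \<in> F" "y \<in> B" | "x \<in> B" "y \<in> F" | "x \<in> B" "y \<in> B"
        using FB xy by blast
      then show ?thesis
      proof cases
        case 1
        then show ?thesis using F_closed F(2) by simp
      next
        case 2
        have "\<alpha> (x \<otimes> y) = inv (x \<otimes> y)" using FB_B 2 B(2) by blast
        also have "\<dots> = inv (y \<otimes> inv x)" using swap 2 by simp
        finally show ?thesis using 2 xy F(2) B(2) by (simp add: inv_mult_group)
      next
        case 3
        have "\<alpha> (x \<otimes> y) = inv (x \<otimes> y)" using FB_B 3 B(2) by blast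
        also have "\<dots> = inv (inv y \<otimes> x)" using swap' 3 by simp
        finally show ?thesis using 3 xy F(2) B(2) by (simp add: inv_mult_group)
      next
        case 4
        \<comment> \<open>Here \<open>x \<otimes> y\<close> lies in \<open>F\<close> and is inverted
          by conjugation with \<open>x\<close>. This unwinds to
          \<open>inv x \<otimes> inv y = x \<otimes> y\<close>, the required value.\<close>
        have "inv (x \<otimes> y) \<otimes> x = x \<otimes> (x \<otimes> y)"
          using swap'[OF BB_F[OF 4] 4(1)] .
        then have "inv x \<otimes> (inv (x \<otimes> y) \<otimes> x) \<otimes> inv x = inv x \<otimes> (x \<otimes> (x \<otimes> y)) \<otimes> inv x" by simp
        moreover have "x \<otimes> y \<otimes> x = x \<otimes> inv (x \<otimes> y)"
          using swap[OF BB_F[OF 4] 4(1)] .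
        ultimately have "inv x \<otimes> inv y = x \<otimes> y"
          using xy swap[OF BB_F[OF 4] 4(1)] swap'[OF BB_F[OF 4] 4(1)]
          by (simp add: inv_mult_group m_assoc)
        then show ?thesis using 4 F(2)[OF BB_F[OF 4]] B(2) by simp
      qed
    qed
    then show ?thesis using \<alpha> unfolding hom_def by auto
  qed
  have nonempty: "\<exists>a\<in>F. inv a \<noteq> a" if "\<not> preserves_colors G (\<lambda>x. inv x)"
  proof (rule ccontr)
    assume "\<not> (\<exists>a\<in>F. inv a \<noteq> a)"
    then have "\<alpha> x = inv x" if "x \<in> carrier G" for x
      using FB[OF that] F B by metis
    then have "preserves_colors G (\<lambda>x. inv x)"
      using pres unfolding preserves_colors_def by simp
    then show False using that by blast
  qed
  have pres_inv: "preserves_colors G (\<lambda>x. inv x)"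
    if x: "x \<in> F" and y: "y \<in> F" and "x \<otimes> y \<in> B" for x y
  proof -
    define k where "k = x \<otimes> y"
    have k: "k \<in> B" "k \<in> carrier G" using that F by (auto simp: k_def)
    \<comment> \<open>Moving \<open>u\<close> past \<open>x\<close> and then past \<open>y\<close>
      inverts each of them, so \<open>u \<otimes> k\<close> is
      \<open>inv x \<otimes> inv y \<otimes> u\<close>. That \<open>inv x \<otimes> inv y\<close> is
      again \<open>k\<close> follows because \<open>k\<close> lies in \<open>B\<close> and itself
      inverts \<open>x\<close> and \<open>y\<close>.\<close>
    have comm_k: "u \<otimes> k = k \<otimes> u" if u: "u \<in> B" for u
    proof -
      have "u \<otimes> k = (u \<otimes> x) \<otimes> y" unfolding k_def using F(1) x y B(1)[OF u] by (simp add: m_assoc)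
      also have "\<dots> = inv x \<otimes> (u \<otimes> y)"
        using swap'[OF x u, symmetric] F(1) x y B(1)[OF u] by (simp add: m_assoc)
      also have "\<dots> = inv x \<otimes> inv y \<otimes> u"
        using swap'[OF y u, symmetric] F(1) x y B(1)[OF u] by (simp add: m_assoc)
      also have "inv x \<otimes> inv y = x \<otimes> y"
      proof -
        have "y \<otimes> (x \<otimes> y) = (x \<otimes> y) \<otimes> inv y" using swap[OF y] k(1) unfolding k_def by blast
        then have "inv y \<otimes> (y \<otimes> (x \<otimes> y)) = inv y \<otimes> (x \<otimes> y \<otimes> inv y)" by simp
        then have "x \<otimes> y = inv y \<otimes> x" using F(1)[OF x] F(1)[OF y] by (simp add: m_assoc)
        have "x \<otimes> (x \<otimes> y) = (x \<otimes> y) \<otimes> inv x" using swap[OF x] k(1) unfolding k_def by blast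
        then have "inv x \<otimes> (x \<otimes> (x \<otimes> y)) = inv x \<otimes> (x \<otimes> y \<otimes> inv x)" by simp
        then have "x \<otimes> y = y \<otimes> inv x" using F(1)[OF x] F(1)[OF y] by (simp add: m_assoc)
        have "y \<otimes> (x \<otimes> y) = x" using \<open>x \<otimes> y = inv y \<otimes> x\<close> F(1)[OF x] F(1)[OF y] by simp
        then have "inv x \<otimes> (inv y \<otimes> (y \<otimes> (x \<otimes> y))) = inv x \<otimes> (inv y \<otimes> x)" by simp
        then have "y = inv x \<otimes> (inv y \<otimes> x)" using F(1)[OF x] F(1)[OF y] by simp
        then have "x \<otimes> y = (inv x \<otimes> inv y) \<otimes> x \<otimes> inv x"
          using \<open>x \<otimes> y = y \<otimes> inv x\<close> F(1)[OF x] F(1)[OF y] by (simp add: m_assoc)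
        then show ?thesis using F(1)[OF x] F(1)[OF y] by (simp add: m_assoc)
      qed
      finally show ?thesis by (simp add: k_def)
    qed
    \<comment> \<open>Conjugation by \<open>k\<close> inverts \<open>F\<close> and fixes \<open>B\<close>.\<close>
    have conj_\<alpha>: "k \<otimes> \<alpha> u \<otimes> inv k = inv u" if u: "u \<in> carrier G" for u
      using FB[OF u]
    proof
      assume u: "u \<in> F"
      then show ?thesis using F[OF u] k(2) swap'[OF u k(1), symmetric] by (simp add: m_assoc)
    next
      assume "u \<in> B"
      then have "inv u \<otimes> (u \<otimes> k) \<otimes> inv u = inv u \<otimes> (k \<otimes> u) \<otimes> inv u" using comm_k by simp
      then have "k \<otimes> inv u = inv u \<otimes> k" using u k by (simp add: m_assoc)
      then show ?thesis using B(2)[OF \<open>u \<in> B\<close>] u k by (simp add: m_assoc)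
    qed
    have conj_k: "k \<otimes> w \<otimes> inv k \<in> {w, inv w}" if w: "w \<in> carrier G" for w
      using FB[OF w]
    proof
      assume w: "w \<in> F"
      then show ?thesis using F[OF w] k(2) swap'[OF w k(1), symmetric] by (simp add: m_assoc)
    next
      assume "w \<in> B"
      then show ?thesis using comm_k w k by (simp add: m_assoc flip: comm_k)
    qed
    \<comment> \<open>Inversion is \<alpha> followed by conjugation by \<open>k\<close>. The former
      changes quotients at most to their inverses by assumption, the latter by
      \<open>conj_k\<close>.\<close>
    have "inv (inv u) \<otimes> inv v \<in> {inv u \<otimes> v, inv v \<otimes> u}"
      if uv: "u \<in> carrier G" "v \<in> carrier G" for u v
    proof -
      have \<alpha>uv: "\<alpha> u \<in> carrier G" "\<alpha> v \<in> carrier G" using uv \<alpha> by auto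
      have "inv (inv u) \<otimes> inv v = inv (k \<otimes> \<alpha> u \<otimes> inv k) \<otimes> (k \<otimes> \<alpha> v \<otimes> inv k)"
        using conj_\<alpha> uv by simp
      also have "\<dots> = k \<otimes> (inv (\<alpha> u) \<otimes> \<alpha> v) \<otimes> inv k"
        using \<alpha>uv k by (simp add: m_assoc inv_mult_group)
      also have "\<dots> \<in> {inv (\<alpha> u) \<otimes> \<alpha> v, inv (\<alpha> v) \<otimes> \<alpha> u}"
        using conj_k[of "inv (\<alpha> u) \<otimes> \<alpha> v"] \<alpha>uv by (simp add: inv_mult_group)
      also have "\<dots> \<subseteq> {inv u \<otimes> v, inv v \<otimes> u}"
        using diff[OF uv] diff[OF uv(2,1)] by auto
      finally show ?thesis .
    qed
    then show ?thesis unfolding preserves_colors_def by blast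
  qed
  show pres': "preserves_colors G (\<lambda>x. inv x)"
  proof (rule ccontr)
    assume neg: "\<not> preserves_colors G (\<lambda>x. inv x)"
    then obtain a where "a \<in> F" "inv a \<noteq> a" using nonempty by blast
    moreover have "x \<otimes> y \<in> F" if "x \<in> F" "y \<in> F" for x y
      using pres_inv that neg FB F(1) by (meson m_closed)
    ultimately show False using closed_hom not_hom by blast
  qed
  show "\<not> comm_group G"
  proof
    assume "comm_group G"
    then interpret comm_group G .
    \<comment> \<open>In an abelian group \<open>swap\<close> forces every fixed element to be its
      own inverse once \<open>B\<close> is nonempty. So \<alpha> is the identity or inversion, and
      both are homomorphisms.\<close>
    have sq: "b \<otimes> f = b \<otimes> inv f" if "f \<in> F" "b \<in> B" for f b
      using swap[OF that] F(1)[OF that(1)] B(1)[OF that(2)] by (simp add: m_comm)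
    have "\<alpha> (x \<otimes> y) = \<alpha> x \<otimes> \<alpha> y" if xy: "x \<in> carrier G" "y \<in> carrier G" for x y
    proof (cases "B = {}")
      case True
      then show ?thesis using FB F(2) xy by simp
    next
      case False
      then obtain b where "b \<in> B" by blast
      then have "\<alpha> x = inv x" if "x \<in> carrier G" for x
        using FB[OF that] sq[of x b] F B that by (metis inv_closed l_cancel)
      then show ?thesis using xy by (simp add: inv_mult)
    qed
    then show False using not_hom \<alpha> unfolding hom_def by auto
  qed
qed

section \<open>Powers and commutators\<close>

lemma pow_commutes_self:
  assumes "x \<in> carrier G"
  shows "x [^] (n::nat) \<otimes> x = x \<otimes> x [^] n"
  using nat_pow_comm[OF assms, of n 1] assms by simp

lemma pow_mod_eq:
  assumes "x \<in> carrier G" "x [^] (n::nat) = \<one>"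
  shows "x [^] (i mod n) = x [^] (i::nat)"
proof -
  have "(x [^] n) [^] (i div n) \<otimes> x [^] (i mod n) = x [^] i"
    using assms(1) by (simp add: nat_pow_pow nat_pow_mult)
  then show ?thesis using assms by simp
qed

text \<open>Each factor \<open>x\<close> that passes \<open>y\<close> leaves one \<open>c\<close>,
  and these can be collected on the right because \<open>c\<close> commutes with
  \<open>x\<close>.\<close>

lemma pow_commutator:
  assumes "x \<in> carrier G" "y \<in> carrier G" "c \<in> carrier G"
    and "x \<otimes> y = y \<otimes> x \<otimes> c" "c \<otimes> x = x \<otimes> c"
  shows "x [^] (n::nat) \<otimes> y = y \<otimes> x [^] n \<otimes> c [^] n"
proof (induction n)
  case (Suc n)
  have "c [^] n \<otimes> x = x \<otimes> c [^] n"
    using assms pow_mult_distrib by (intro group_commutes_pow) auto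
  have "x [^] Suc n \<otimes> y = x [^] n \<otimes> (x \<otimes> y)"
    using assms by (simp add: m_assoc)
  also have "\<dots> = (x [^] n \<otimes> y) \<otimes> x \<otimes> c"
    unfolding assms(4) using assms by (simp add: m_assoc)
  also have "\<dots> = y \<otimes> x [^] n \<otimes> (c [^] n \<otimes> x) \<otimes> c"
    unfolding Suc using assms by (simp add: m_assoc)
  also have "\<dots> = y \<otimes> x [^] Suc n \<otimes> c [^] Suc n"
    unfolding \<open>c [^] n \<otimes> x = x \<otimes> c [^] n\<close> using assms by (simp add: m_assoc)
  finally show ?case .
qed (use assms in simp)

text \<open>A cyclic 2-group has at most one involution: \<open>2 ^ a\<close> divides
  \<open>2 * i\<close> but not \<open>i\<close>, so \<open>i\<close> is an odd multiple of
  \<open>2 ^ (a - 1)\<close>.\<close>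

lemma involution_in_cyclic_two_group:
  assumes x: "x \<in> carrier G" "ord x = 2 ^ a"
    and i: "x [^] (i::nat) \<noteq> \<one>" "x [^] i \<otimes> x [^] i = \<one>"
  obtains a' where "a = Suc a'" "x [^] i = x [^] ((2::nat) ^ a')"
proof -
  have dvd: "2 ^ a dvd i + i" "\<not> 2 ^ a dvd i"
    using assms pow_eq_id[OF x(1)] by (simp_all add: nat_pow_mult)
  then have "a \<noteq> 0" by (intro notI) simp
  then obtain a' where a': "a = Suc a'" using not0_implies_Suc by blast
  then have "2 ^ a' dvd i" using dvd(1) by (simp flip: mult_2)
  then obtain m where m: "i = 2 ^ a' * m" by blast
  then have "odd m" using dvd(2) a' by (auto simp: mult.commute)
  then obtain q where "m = 2 * q + 1" by (rule oddE)
  then have "i = 2 ^ a * q + 2 ^ a'" using m a' by (simp add: algebra_simps)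
  then have "x [^] i = (x [^] ((2::nat) ^ a)) [^] q \<otimes> x [^] ((2::nat) ^ a')"
    using x by (simp add: nat_pow_pow nat_pow_mult)
  moreover have "x [^] ((2::nat) ^ a) = \<one>" using x by (metis pow_ord_eq_1)
  ultimately have "x [^] i = x [^] ((2::nat) ^ a')" using x by simp
  then show ?thesis using a' that by blast
qed

text \<open>Reordering \<open>(u \<otimes> y) \<otimes> (u \<otimes> y)\<close> costs one factor
  \<open>d\<close>. Passing \<open>y\<close> across \<open>u \<otimes> u\<close> costs two, which
  cancel, so the squares of \<open>u\<close> and \<open>y\<close> and the factor \<open>d\<close>
  can be raised to the power \<open>m\<close> separately.\<close>

lemma pow_double_mult:
  assumes uyd: "u \<in> carrier G" "y \<in> carrier G" "d \<in> carrier G"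
    and uy: "u \<otimes> y = y \<otimes> u \<otimes> d" and du: "d \<otimes> u = u \<otimes> d" and dy: "d \<otimes> y = y \<otimes> d"
    and dd: "d \<otimes> d = \<one>"
  shows "(u \<otimes> y) [^] (2 * m :: nat) = d [^] m \<otimes> (u [^] (2 * m) \<otimes> y [^] (2 * m))"
proof -
  have yu: "y \<otimes> u = u \<otimes> y \<otimes> d"
    unfolding uy using uyd dd by (simp add: m_assoc)
  have "u \<otimes> u \<otimes> y = u \<otimes> (u \<otimes> y)" using uyd by (simp add: m_assoc)
  also have "\<dots> = u \<otimes> (y \<otimes> u \<otimes> d)" by (simp only: uy)
  also have "\<dots> = (u \<otimes> y) \<otimes> u \<otimes> d" using uyd by (simp add: m_assoc)
  also have "\<dots> = y \<otimes> u \<otimes> (d \<otimes> u) \<otimes> d" unfolding uy using uyd by (simp add: m_assoc)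
  also have "\<dots> = y \<otimes> (u \<otimes> u)" unfolding du using uyd dd by (simp add: m_assoc)
  finally have uu_y: "u \<otimes> u \<otimes> y = y \<otimes> (u \<otimes> u)" .
  have comm1: "u \<otimes> u \<otimes> (y \<otimes> y) = y \<otimes> y \<otimes> (u \<otimes> u)"
  proof -
    have "u \<otimes> u \<otimes> (y \<otimes> y) = (u \<otimes> u \<otimes> y) \<otimes> y" using uyd by (simp add: m_assoc)
    also have "\<dots> = y \<otimes> (u \<otimes> u \<otimes> y)" unfolding uu_y using uyd uu_y by (simp add: m_assoc)
    finally show ?thesis unfolding uu_y using uyd by (simp add: m_assoc)
  qed
  have d_uu: "d \<otimes> (u \<otimes> u) = (u \<otimes> u) \<otimes> d"
    using du uyd by (metis m_assoc m_closed)
  have d_yy: "d \<otimes> (y \<otimes> y) = (y \<otimes> y) \<otimes> d"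
    using dy uyd by (metis m_assoc m_closed)
  have "d \<otimes> (u \<otimes> u \<otimes> (y \<otimes> y)) = (u \<otimes> u) \<otimes> (d \<otimes> (y \<otimes> y))"
    using d_uu uyd by (metis m_assoc m_closed)
  then have comm2: "d \<otimes> (u \<otimes> u \<otimes> (y \<otimes> y)) = (u \<otimes> u \<otimes> (y \<otimes> y)) \<otimes> d"
    unfolding d_yy using uyd by (simp add: m_assoc)
  have "(u \<otimes> y) [^] (2::nat) = u \<otimes> (y \<otimes> u) \<otimes> y"
    using uyd by (simp add: pow_numeral_eq m_assoc)
  also have "\<dots> = u \<otimes> u \<otimes> y \<otimes> (d \<otimes> y)"
    unfolding yu using uyd by (simp add: m_assoc)
  also have "\<dots> = (u \<otimes> u \<otimes> (y \<otimes> y)) \<otimes> d"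
    unfolding dy using uyd by (simp add: m_assoc)
  also have "\<dots> = d \<otimes> (u [^] (2::nat) \<otimes> y [^] (2::nat))"
    unfolding comm2[symmetric] using uyd by (simp add: pow_numeral_eq)
  finally have "(u \<otimes> y) [^] (2 * m) = (d \<otimes> (u [^] (2::nat) \<otimes> y [^] (2::nat))) [^] m"
    using uyd by (simp flip: nat_pow_pow)
  also have "\<dots> = d [^] m \<otimes> ((u [^] (2::nat) \<otimes> y [^] (2::nat)) [^] m)"
    using uyd comm2 by (intro pow_mult_distrib) (simp_all add: pow_numeral_eq)
  also have "(u [^] (2::nat) \<otimes> y [^] (2::nat)) [^] m = (u [^] (2::nat)) [^] m \<otimes> (y [^] (2::nat)) [^] m"
    using uyd comm1 by (intro pow_mult_distrib) (simp_all add: pow_numeral_eq)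
  finally show ?thesis using uyd by (simp add: nat_pow_pow)
qed

section \<open>Noncommuting pairs of minimal order\<close>

text \<open>The commutator \<open>c\<close> is the unique involution both of the powers of
  \<open>x\<close> and of the powers of \<open>y\<close>. Unless both orders are 4, multiplying
  \<open>y\<close> by a power of \<open>x\<close> cancels this involution and lowers the order of
  \<open>y\<close>, against minimality.\<close>

lemma quaternion_pair_if_minimal:
  assumes x: "x \<in> carrier G" "ord x = 2 ^ a" and y: "y \<in> carrier G" "ord y = 2 ^ b" and "b \<le> a"
    and c: "c \<in> carrier G" "x \<otimes> y = y \<otimes> x \<otimes> c" "c \<noteq> \<one>" "c \<otimes> c = \<one>"
    and ij: "c = x [^] (i::nat)" "c = y [^] (j::nat)"
    and min: "\<And>z. z \<in> carrier G \<Longrightarrow> ord z < ord y \<Longrightarrow> x \<otimes> z = z \<otimes> x"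
  shows "x \<otimes> x = c \<and> y \<otimes> y = c"
proof -
  obtain a' where "a = Suc a'" "x [^] i = x [^] ((2::nat) ^ a')"
    using involution_in_cyclic_two_group[OF x c(3,4)[unfolded ij(1)]] .
  with ij(1) have a': "a = Suc a'" "c = x [^] ((2::nat) ^ a')" by simp_all
  obtain b' where "b = Suc b'" "y [^] j = y [^] ((2::nat) ^ b')"
    using involution_in_cyclic_two_group[OF y c(3,4)[unfolded ij(2)]] .
  with ij(2) have b': "b = Suc b'" "c = y [^] ((2::nat) ^ b')" by simp_all
  have cx: "c \<otimes> x = x \<otimes> c" unfolding ij(1) by (rule pow_commutes_self[OF x(1)])
  have cy: "c \<otimes> y = y \<otimes> c" unfolding ij(2) by (rule pow_commutes_self[OF y(1)])
  have noncomm: "x \<otimes> y \<noteq> y \<otimes> x"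
  proof
    assume "x \<otimes> y = y \<otimes> x"
    then have "y \<otimes> x = y \<otimes> x \<otimes> c" using c(2) by simp
    then show False using c(1,3) x(1) y(1) by simp
  qed
  have "b' \<noteq> 0"
  proof
    assume "b' = 0"
    then have "c = y" using b' y(1) by simp
    then show False using cx noncomm by simp
  qed
  have "\<not> a' \<ge> 2"
  proof
    assume "a' \<ge> 2"
    \<comment> \<open>The element \<open>x\<^sup>k y\<close> has smaller order than \<open>y\<close>, but does not commute with \<open>x\<close>.\<close>
    define k m :: nat where "k = 2 ^ (a' - b')" and "m = 2 ^ (b' - 1)"
    define u where "u = x [^] k"
    have b'_le: "b' \<le> a'" using \<open>b \<le> a\<close> a' b' by simp
    have m2: "2 * m = 2 ^ b'" using \<open>b' \<noteq> 0\<close> unfolding m_def by (simp flip: power_Suc)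
    \<comment> \<open>The exponent \<open>k\<close> is chosen so that \<open>u\<close> and
      \<open>y\<close> have the same power \<open>c\<close> at \<open>2 ^ b'\<close>; this exponent
      is written \<open>2 * m\<close> to fit \<open>pow_double_mult\<close>.\<close>
    have km2: "k * (2 * m) = 2 ^ a'" unfolding m2 unfolding k_def using b'_le by (simp flip: power_add)
    \<comment> \<open>Evenness of \<open>k * m\<close>, which needs \<open>a' \<ge> 2\<close>,
      removes the commutator factor \<open>c [^] (k * m)\<close>.\<close>
    have "2 * (k * m) = 2 * 2 ^ (a' - 1)"
      using km2 \<open>a' \<ge> 2\<close> by (simp add: mult.left_commute flip: power_Suc)
    then have "even (k * m)" using \<open>a' \<ge> 2\<close> by simp
    then obtain l where l: "k * m = 2 * l" by blast
    have c2: "c [^] (2::nat) = \<one>" using c by (simp add: pow_numeral_eq)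
    have u: "u \<in> carrier G" unfolding u_def using x by simp
    have uy: "u \<otimes> y = y \<otimes> u \<otimes> c [^] k"
      unfolding u_def by (rule pow_commutator) (use x y c cx in auto)
    have "(u \<otimes> y) [^] (2 * m) = (c [^] k) [^] m \<otimes> (u [^] (2 * m) \<otimes> y [^] (2 * m))"
    proof (rule pow_double_mult[OF u y(1) _ uy])
      show "c [^] k \<otimes> u = u \<otimes> c [^] k"
        unfolding u_def ij(1) using x(1) by (simp add: nat_pow_pow nat_pow_mult add.commute)
      show "c [^] k \<otimes> y = y \<otimes> c [^] k"
        unfolding ij(2) nat_pow_pow[OF y(1)] by (rule pow_commutes_self[OF y(1)])
      have "c [^] k \<otimes> c [^] k = (c [^] (2::nat)) [^] k"
        using c(1) by (simp add: nat_pow_pow nat_pow_mult mult_2)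
      then show "c [^] k \<otimes> c [^] k = \<one>" using c2 by simp
    qed (use c in simp)
    also have "(c [^] k) [^] m = (c [^] (2::nat)) [^] l"
      using c(1) l by (simp add: nat_pow_pow)
    also have "u [^] (2 * m) = c"
      unfolding u_def a'(2) using x(1) km2 by (simp add: nat_pow_pow)
    also have "y [^] (2 * m) = c"
      unfolding m2 b'(2) ..
    finally have "(u \<otimes> y) [^] ((2::nat) ^ b') = \<one>"
      using c c2 m2 by simp
    then have "ord (u \<otimes> y) dvd 2 ^ b'"
      using pow_eq_id u y(1) by simp
    then have "ord (u \<otimes> y) \<le> 2 ^ b'" by (simp add: dvd_imp_le)
    also have "(2::nat) ^ b' < ord y" using y(2) b'(1) by simp
    finally have "x \<otimes> (u \<otimes> y) = (u \<otimes> y) \<otimes> x" using min u y(1) by simp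
    moreover have "x \<otimes> u = u \<otimes> x"
      unfolding u_def by (rule pow_commutes_self[OF x(1), symmetric])
    ultimately have "u \<otimes> (x \<otimes> y) = u \<otimes> (y \<otimes> x)"
      using x(1) y(1) u by (metis m_assoc)
    then show False using noncomm x(1) y(1) u by simp
  qed
  then have "a' = 1" "b' = 1" using \<open>b \<le> a\<close> \<open>b' \<noteq> 0\<close> a' b' by simp_all
  then show ?thesis using a' b' x(1) y(1) by (simp add: pow_numeral_eq)
qed

section \<open>Conjugates and commutators in Hamiltonian 2-groups\<close>

text \<open>The cyclic subgroup of \<open>x\<close> is normal, and since \<open>ord x\<close> is a
  power of 2, hence nonzero, natural exponents suffice to describe it.\<close>

lemma conj_pow_if_hamiltonian:
  assumes "hamiltonian_two_group G" "x \<in> carrier G" "y \<in> carrier G"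
  obtains k :: nat where "y \<otimes> x \<otimes> inv y = x [^] k"
proof -
  have "ord x \<noteq> 0"
    using assms unfolding hamiltonian_two_group_def two_group_def by force
  then have gen: "generate G {x} = {x [^] k | k. k \<in> (UNIV :: nat set)}"
    using generate_pow_nat assms(2) by blast
  have normal: "generate G {x} \<lhd> G"
    using assms generate_is_subgroup[of "{x}"] unfolding hamiltonian_two_group_def by simp
  have "y \<otimes> x \<otimes> inv y \<in> generate G {x}"
    by (rule normal.inv_op_closed2[OF normal assms(3)]) (simp add: generate.incl)
  then show ?thesis using gen that by blast
qed

text \<open>The conjugate is a power of \<open>x\<close> with exponent modulo 4. Exponents 1 and 3
  are the two claimed values; 0 and 2 force \<open>x = \<one>\<close>, since only
  \<open>\<one>\<close> has a trivial conjugate.\<close>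

lemma conj_eq_self_or_inv:
  assumes "hamiltonian_two_group G" and xy: "x \<in> carrier G" "y \<in> carrier G"
    and x4: "x [^] (4::nat) = \<one>"
  shows "y \<otimes> x \<otimes> inv y \<in> {x, inv x}"
proof -
  obtain k :: nat where "y \<otimes> x \<otimes> inv y = x [^] k"
    using conj_pow_if_hamiltonian assms(1-3) .
  then have conj: "y \<otimes> x \<otimes> inv y = x [^] (k mod 4)"
    using pow_mod_eq[OF xy(1) x4, of k] by simp
  have x4': "x \<otimes> x \<otimes> (x \<otimes> x) = \<one>"
    using x4 xy by (simp add: pow_numeral_eq)
  have one_if: "z = \<one>" if "z \<in> carrier G" "y \<otimes> z \<otimes> inv y = \<one>" for z
  proof -
    have "inv y \<otimes> (y \<otimes> z \<otimes> inv y) \<otimes> y = \<one>" unfolding that(2) using xy by simp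
    then show ?thesis using that(1) xy by (simp add: m_assoc)
  qed
  have "k mod 4 < 4" by simp
  then consider "k mod 4 = 0" | "k mod 4 = 1" | "k mod 4 = 2" | "k mod 4 = 3" by linarith
  then show ?thesis
  proof cases
    case 1
    then have "x = \<one>" using conj one_if[OF xy(1)] by simp
    then show ?thesis using xy by simp
  next
    case 2
    then show ?thesis using conj xy by simp
  next
    case 3
    then have *: "y \<otimes> x \<otimes> inv y = x \<otimes> x"
      using conj xy by (simp add: pow_numeral_eq)
    have "y \<otimes> (x \<otimes> x) \<otimes> inv y = (y \<otimes> x \<otimes> inv y) \<otimes> (y \<otimes> x \<otimes> inv y)"
      using xy by (simp add: m_assoc)
    then have "x \<otimes> x = \<one>" unfolding * x4' using one_if xy by simp
    then have "x = \<one>" using * one_if[OF xy(1)] by simp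
    then show ?thesis using xy by simp
  next
    case 4
    have "x [^] (3::nat) \<otimes> x = \<one>" using x4 xy by (simp add: eval_nat_numeral)
    then have "inv x = x [^] (3::nat)" using xy by (intro inv_equality) simp_all
    then show ?thesis using conj 4 by simp
  qed
qed

text \<open>The commutator is \<open>inv x\<close> times a conjugate of \<open>x\<close>, and also a
  conjugate of \<open>inv y\<close> times \<open>y\<close>, so it lies in both cyclic
  subgroups.\<close>

lemma hamiltonian_commutator:
  assumes ham: "hamiltonian_two_group G" and xy: "x \<in> carrier G" "y \<in> carrier G"
  obtains c i j where "c \<in> carrier G" "x \<otimes> y = y \<otimes> x \<otimes> c"
    "c = x [^] (i::nat)" "c = y [^] (j::nat)"
proof -
  define c where "c = inv x \<otimes> inv y \<otimes> x \<otimes> y"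
  have inv_pow: "\<exists>n::nat. inv z = z [^] n" if z: "z \<in> carrier G" for z
  proof -
    have "ord z \<noteq> 0"
      using ham z unfolding hamiltonian_two_group_def two_group_def by force
    then have "generate G {z} = {z [^] k | k. k \<in> (UNIV :: nat set)}"
      using generate_pow_nat z by blast
    moreover have "inv z \<in> generate G {z}" by (simp add: generate.inv)
    ultimately show ?thesis by blast
  qed
  obtain n :: nat where n: "inv x = x [^] n" using inv_pow xy by blast
  obtain k :: nat where k: "inv y \<otimes> x \<otimes> inv (inv y) = x [^] k"
    using conj_pow_if_hamiltonian[OF ham xy(1), of "inv y"] xy by blast
  have "c = inv x \<otimes> (inv y \<otimes> x \<otimes> inv (inv y))"
    unfolding c_def using xy by (simp add: m_assoc)
  also have "\<dots> = x [^] (n + k)" unfolding k n using xy by (simp add: nat_pow_mult)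
  finally have i: "c = x [^] (n + k)" .
  obtain l :: nat where l: "inv x \<otimes> y \<otimes> inv (inv x) = y [^] l"
    using conj_pow_if_hamiltonian[OF ham xy(2), of "inv x"] xy by blast
  obtain p :: nat where p: "inv (y [^] l) = (y [^] l) [^] p"
    using inv_pow xy by (metis nat_pow_closed)
  have "c = inv (inv x \<otimes> y \<otimes> inv (inv x)) \<otimes> y"
    unfolding c_def using xy by (simp add: m_assoc inv_mult_group)
  also have "\<dots> = y [^] (l * p + 1)" unfolding l p using xy by (simp add: nat_pow_pow)
  finally have j: "c = y [^] (l * p + 1)" .
  have "x \<otimes> y = y \<otimes> x \<otimes> c" "c \<in> carrier G"
    unfolding c_def using xy by (simp_all add: m_assoc)
  then show ?thesis using that i j by blast
qed

section \<open>A quaternion subgroup and exponent four\<close>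

text \<open>These relations make \<open>x\<close> and \<open>y\<close> generate a quaternion group
  of order 8 with central involution \<open>c\<close>. The pair is a noncommuting one with least sum
  of orders.\<close>

lemma quaternion_pair_if_hamiltonian:
  assumes ham: "hamiltonian_two_group G"
  obtains x y c where "x \<in> carrier G" "y \<in> carrier G" "c \<in> carrier G"
    "x \<otimes> y = y \<otimes> x \<otimes> c" "c \<noteq> \<one>" "c \<otimes> c = \<one>" "x \<otimes> x = c" "y \<otimes> y = c"
proof -
  have pow2: "\<exists>n::nat. ord z = 2 ^ n" if "z \<in> carrier G" for z
    using ham that unfolding hamiltonian_two_group_def two_group_def by blast
  define P where "P = (\<lambda>(x, y). x \<in> carrier G \<and> y \<in> carrier G \<and> x \<otimes> y \<noteq> y \<otimes> x)"
  have "\<exists>p. P p"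
    using ham group_comm_groupI unfolding hamiltonian_two_group_def P_def by auto
  then obtain p where p: "P p" "\<And>q. P q \<Longrightarrow> ord (fst p) + ord (snd p) \<le> ord (fst q) + ord (snd q)"
    using ex_has_least_nat[of P _ "\<lambda>q. ord (fst q) + ord (snd q)"] by blast
  obtain x y where "p = (x, y)" by fastforce
  with p have xy: "x \<in> carrier G" "y \<in> carrier G" "x \<otimes> y \<noteq> y \<otimes> x"
    and min: "\<And>u v. u \<in> carrier G \<Longrightarrow> v \<in> carrier G \<Longrightarrow> u \<otimes> v \<noteq> v \<otimes> u \<Longrightarrow>
      ord x + ord y \<le> ord u + ord v"
    unfolding P_def by fastforce+
  obtain c i j where c: "c \<in> carrier G" "x \<otimes> y = y \<otimes> x \<otimes> c"
    and ij: "c = x [^] (i::nat)" "c = y [^] (j::nat)"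
    using hamiltonian_commutator[OF ham xy(1,2)] .
  have "c \<noteq> \<one>" using c xy by auto
  obtain a where a: "ord x = 2 ^ a" using pow2 xy by blast
  obtain b where b: "ord y = 2 ^ b" using pow2 xy by blast
  have cx: "c \<otimes> x = x \<otimes> c" unfolding ij(1) by (rule pow_commutes_self[OF xy(1)])
  \<comment> \<open>The square of \<open>x\<close> has half the order, so by minimality it commutes
    with \<open>y\<close>; comparison with \<open>pow_commutator\<close> then yields
    \<open>c [^] 2 = \<one>\<close>.\<close>
  have "x [^] (2::nat) \<otimes> y = y \<otimes> x [^] (2::nat)"
  proof (rule ccontr)
    assume "x [^] (2::nat) \<otimes> y \<noteq> y \<otimes> x [^] (2::nat)"
    then have le: "ord x \<le> ord (x [^] (2::nat))" using min[of "x [^] (2::nat)" y] xy by simp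
    have "a \<noteq> 0"
    proof
      assume "a = 0"
      then have "x = \<one>" using a ord_eq_1[OF xy(1)] by simp
      then show False using xy by simp
    qed
    then have "2 dvd ord x" using a by simp
    then have "ord (x [^] (2::nat)) = ord x div 2" using xy by (intro ord_pow) simp_all
    moreover have "0 < ord x" using a by simp
    ultimately show False using le by linarith
  qed
  moreover have "x [^] (2::nat) \<otimes> y = y \<otimes> x [^] (2::nat) \<otimes> c [^] (2::nat)"
    using pow_commutator[OF xy(1,2) c cx] .
  ultimately have "c [^] (2::nat) = \<one>" using xy c by simp
  then have cc: "c \<otimes> c = \<one>" using c by (simp add: pow_numeral_eq)
  have "x \<otimes> x = c \<and> y \<otimes> y = c"
  proof (cases "b \<le> a")
    case True
    have "x \<otimes> z = z \<otimes> x" if "z \<in> carrier G" "ord z < ord y" for z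
      using min[of x z] that xy by fastforce
    then show ?thesis
      using quaternion_pair_if_minimal[OF xy(1) a xy(2) b True c \<open>c \<noteq> \<one>\<close> cc ij] by blast
  next
    case False
    have "y \<otimes> z = z \<otimes> y" if "z \<in> carrier G" "ord z < ord x" for z
      using min[of y z] that xy by fastforce
    \<comment> \<open>Exchanging the roles of \<open>x\<close> and \<open>y\<close> inverts the
      commutator, and \<open>c\<close> is its own inverse.\<close>
    moreover have "y \<otimes> x = x \<otimes> y \<otimes> c"
      unfolding c(2) using c(1) xy cc by (simp add: m_assoc)
    ultimately have "y \<otimes> y = c \<and> x \<otimes> x = c"
      using quaternion_pair_if_minimal[OF xy(2) b xy(1) a _ c(1) _ \<open>c \<noteq> \<one>\<close> cc ij(2,1)] False
      by simp
    then show ?thesis by blast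
  qed
  then show ?thesis using that xy c \<open>c \<noteq> \<one>\<close> cc by blast
qed

lemma pow4_if_centralizes_quaternion_pair:
  assumes ham: "hamiltonian_two_group G"
    and x: "x \<in> carrier G" and y: "y \<in> carrier G" and c: "c \<in> carrier G"
    and xy: "x \<otimes> y = y \<otimes> x \<otimes> c" "c \<noteq> \<one>" "c \<otimes> c = \<one>" "x \<otimes> x = c" "y \<otimes> y = c"
    and z: "z \<in> carrier G" "z \<otimes> x = x \<otimes> z" "z \<otimes> y = y \<otimes> z"
  shows "z [^] (4::nat) = \<one>"
proof (rule ccontr)
  \<comment> \<open>Otherwise some power \<open>w\<close> of \<open>z\<close> has order \<open>4\<close>, and \<open>\<langle>x w\<rangle>\<close> misses the commutator \<open>c\<close> of \<open>x w\<close> and \<open>y\<close>.\<close>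
  assume z4: "z [^] (4::nat) \<noteq> \<one>"
  obtain k where k: "ord z = 2 ^ k"
    using ham z unfolding hamiltonian_two_group_def two_group_def by blast
  have "k > 2"
  proof (rule ccontr)
    assume "\<not> k > 2"
    then have "2 ^ k dvd (2::nat) ^ 2" by (intro le_imp_power_dvd) simp
    then show False using z4 k pow_eq_id[OF z(1), of 4] by simp
  qed
  \<comment> \<open>With this exponent \<open>w\<close> has order exactly 4.\<close>
  define l where "l = k - 2"
  have l: "k = Suc (Suc l)" unfolding l_def using \<open>k > 2\<close> by simp
  define w where "w = z [^] ((2::nat) ^ l)"
  have w: "w \<in> carrier G" unfolding w_def using z by simp
  have w_comm: "w \<otimes> x = x \<otimes> w" "w \<otimes> y = y \<otimes> w"
    unfolding w_def using z x y by (auto intro: group_commutes_pow)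
  have "w [^] (4::nat) = \<one>" "w [^] (2::nat) \<noteq> \<one>"
    unfolding w_def using z k l pow_eq_id[OF z(1)] by (simp_all add: nat_pow_pow)
  then have w4: "w \<otimes> w \<otimes> (w \<otimes> w) = \<one>" and w2: "w \<otimes> w \<noteq> \<one>"
    using w by (simp_all add: pow_numeral_eq)
  define v where "v = x \<otimes> w"
  have v: "v \<in> carrier G" unfolding v_def using x w by simp
  have cw: "c \<otimes> w = w \<otimes> c"
    unfolding xy(4)[symmetric] using w_comm x w by (metis m_assoc)
  have cy: "c \<otimes> y = y \<otimes> c"
    unfolding xy(5)[symmetric] using y by (simp add: m_assoc)
  have vv: "v \<otimes> v = c \<otimes> (w \<otimes> w)"
  proof -
    have "v \<otimes> v = x \<otimes> (w \<otimes> x) \<otimes> w" unfolding v_def using x w by (simp add: m_assoc)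
    also have "\<dots> = (x \<otimes> x) \<otimes> (w \<otimes> w)" unfolding w_comm using x w by (simp add: m_assoc)
    finally show ?thesis unfolding xy(4) .
  qed
  have vv_y: "v \<otimes> v \<otimes> y = y \<otimes> (v \<otimes> v)"
  proof -
    have "v \<otimes> v \<otimes> y = c \<otimes> (w \<otimes> (w \<otimes> y))" unfolding vv using c w y by (simp add: m_assoc)
    also have "\<dots> = c \<otimes> ((w \<otimes> y) \<otimes> w)" unfolding w_comm using w y w_comm by (simp add: m_assoc[symmetric])
    also have "\<dots> = (c \<otimes> y) \<otimes> (w \<otimes> w)" unfolding w_comm using c w y by (simp add: m_assoc)
    also have "\<dots> = y \<otimes> (v \<otimes> v)" unfolding vv cy using c w y by (simp add: m_assoc)
    finally show ?thesis .
  qed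
  have v4: "v [^] (4::nat) = \<one>"
  proof -
    have cww: "w \<otimes> w \<otimes> c = c \<otimes> (w \<otimes> w)" using cw c w by (metis m_assoc)
    have "v [^] (4::nat) = c \<otimes> (w \<otimes> w \<otimes> c) \<otimes> (w \<otimes> w)"
      unfolding pow_numeral_eq[OF v] vv using c w by (simp add: m_assoc)
    also have "\<dots> = (c \<otimes> c) \<otimes> (w \<otimes> w \<otimes> (w \<otimes> w))"
      unfolding cww using c w by (simp add: m_assoc)
    finally show ?thesis using xy(3) w4 by simp
  qed
  have vy: "v \<otimes> y = y \<otimes> v \<otimes> c"
  proof -
    have "v \<otimes> y = x \<otimes> (w \<otimes> y)" unfolding v_def using x w y by (simp add: m_assoc)
    also have "\<dots> = (x \<otimes> y) \<otimes> w" unfolding w_comm using x w y by (simp add: m_assoc)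
    also have "\<dots> = y \<otimes> x \<otimes> (c \<otimes> w)" unfolding xy(1) using x w y c by (simp add: m_assoc)
    finally show ?thesis unfolding cw v_def using x w y c by (simp add: m_assoc)
  qed
  have vy_ne: "v \<otimes> y \<noteq> y \<otimes> v"
    unfolding vy using v y c xy(2) by simp
  obtain d i j where d: "d \<in> carrier G" "v \<otimes> y = y \<otimes> v \<otimes> d" "d = v [^] (i::nat)" "d = y [^] (j::nat)"
    using hamiltonian_commutator[OF ham v y] .
  have "d = c" using d(1,2) vy c v y by simp
  then have ci: "c = v [^] (i mod 4)" using d(3) pow_mod_eq[OF v v4] by simp
  \<comment> \<open>None of the four powers of \<open>v\<close> can be \<open>c\<close>: the
    exponent 0 gives \<open>\<one>\<close>, the square is
    \<open>c \<otimes> (w \<otimes> w)\<close>, and the odd powers do not commute with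
    \<open>y\<close> because \<open>v\<close> does not while \<open>v \<otimes> v\<close>
    does.\<close>
  have "i mod 4 < 4" by simp
  then consider "i mod 4 = 0" | "i mod 4 = 1" | "i mod 4 = 2" | "i mod 4 = 3" by linarith
  then show False
  proof cases
    case 1
    then show False using ci xy(2) by simp
  next
    case 2
    then show False using ci cy vy_ne v by simp
  next
    case 3
    then have "c = v \<otimes> v" using ci v by (simp add: pow_numeral_eq)
    then have "c = c \<otimes> (w \<otimes> w)" using vv by (rule trans)
    then show False using w2 c w by simp
  next
    case 4
    have "v [^] (3::nat) = v \<otimes> (v \<otimes> v)" using v by (simp add: numeral_eq_Suc m_assoc)
    then have c3: "c = v \<otimes> (v \<otimes> v)" using ci 4 by metis
    have "v \<otimes> (v \<otimes> v \<otimes> y) = y \<otimes> (v \<otimes> (v \<otimes> v))" using cy[unfolded c3] v y by (simp add: m_assoc)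
    then have "(v \<otimes> y) \<otimes> (v \<otimes> v) = (y \<otimes> v) \<otimes> (v \<otimes> v)"
      unfolding vv_y using v y by (simp add: m_assoc)
    then show False using vy_ne v y by simp
  qed
qed

text \<open>Multiplying \<open>g\<close> by \<open>y\<close> if necessary, and then by
  \<open>x\<close> if necessary, gives an element commuting with \<open>x\<close> and
  \<open>y\<close>, to which \<open>pow4_if_centralizes_quaternion_pair\<close> applies. Each
  multiplication is undone without changing the fourth power.\<close>

lemma exponent_four_if_hamiltonian:
  assumes ham: "hamiltonian_two_group G" and g: "g \<in> carrier G"
  shows "g [^] (4::nat) = \<one>"
proof -
  obtain x y c where x: "x \<in> carrier G" and y: "y \<in> carrier G" and c: "c \<in> carrier G"
    and xy: "x \<otimes> y = y \<otimes> x \<otimes> c" "c \<noteq> \<one>" "c \<otimes> c = \<one>" "x \<otimes> x = c" "y \<otimes> y = c"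
    using quaternion_pair_if_hamiltonian[OF ham] .
  have yx: "y \<otimes> x = x \<otimes> y \<otimes> c" unfolding xy(1) using x y c xy(3) by (simp add: m_assoc)
  \<comment> \<open>Such a \<open>q\<close> satisfies \<open>inv q = q \<otimes> c\<close>, so its
    conjugates are \<open>q\<close> and possibly \<open>q \<otimes> c\<close>. Both have square
    \<open>c\<close>, which makes \<open>c\<close> central.\<close>
  have flip: "h \<otimes> q = q \<otimes> h \<or> h \<otimes> q = q \<otimes> h \<otimes> c" and central: "h \<otimes> c = c \<otimes> h"
    if h: "h \<in> carrier G" and q: "q \<in> carrier G" and qq: "q \<otimes> q = c" for h q
  proof -
    have q4: "q [^] (4::nat) = \<one>" using q qq xy(3) by (simp add: pow_numeral_eq)
    have qc: "q \<otimes> c = c \<otimes> q" unfolding qq[symmetric] using q by (simp add: m_assoc)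
    have "inv q = q \<otimes> c" using q c qc qq xy(3) by (intro inv_equality) (simp_all add: m_assoc)
    then have conj: "h \<otimes> q \<otimes> inv h = q \<or> h \<otimes> q \<otimes> inv h = q \<otimes> c"
      using conj_eq_self_or_inv[OF ham q h q4] by auto
    have *: "h \<otimes> q = r \<otimes> h" if "h \<otimes> q \<otimes> inv h = r" for r
      using that h q by (auto simp: m_assoc)
    have "(h \<otimes> q \<otimes> inv h) \<otimes> (h \<otimes> q \<otimes> inv h) = c"
      using conj
    proof
      assume "h \<otimes> q \<otimes> inv h = q \<otimes> c"
      moreover have "q \<otimes> c \<otimes> (q \<otimes> c) = q \<otimes> q \<otimes> (c \<otimes> c)"
        using qc q c by (metis m_assoc m_closed)
      ultimately show ?thesis using qq xy(3) c by simp
    qed (simp add: qq)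
    then have "h \<otimes> (q \<otimes> q) \<otimes> inv h = c" using h q by (simp add: m_assoc)
    then have "(h \<otimes> c \<otimes> inv h) \<otimes> h = c \<otimes> h" unfolding qq by simp
    then show central: "h \<otimes> c = c \<otimes> h" using h c by (simp add: m_assoc)
    show "h \<otimes> q = q \<otimes> h \<or> h \<otimes> q = q \<otimes> h \<otimes> c"
      using conj
    proof
      assume "h \<otimes> q \<otimes> inv h = q \<otimes> c"
      then have "h \<otimes> q = q \<otimes> c \<otimes> h" by (rule *)
      then show ?thesis using central h q c by (simp add: m_assoc)
    qed (use * in blast)
  qed
  \<comment> \<open>The square of \<open>q \<otimes> h\<close> is that of \<open>h\<close> times a
    central factor \<open>f\<close> with \<open>f \<otimes> f = \<one>\<close>, so both have the
    same fourth power.\<close>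
  have pow4_mult: "h [^] (4::nat) = \<one>"
    if h: "h \<in> carrier G" and q: "q \<in> carrier G" "q \<otimes> q = c" and qh: "(q \<otimes> h) [^] (4::nat) = \<one>"
    for q h
  proof -
    obtain e where e: "e \<in> {\<one>, c}" "h \<otimes> q = q \<otimes> h \<otimes> e"
      using flip[OF h q] h q by fastforce
    define f where "f = c \<otimes> e"
    have ef: "e \<in> carrier G" "f \<in> carrier G" "f \<otimes> f = \<one>"
      using e(1) c xy(3) unfolding f_def by auto
    have f_central: "k \<otimes> f = f \<otimes> k" "k \<otimes> e = e \<otimes> k" if "k \<in> carrier G" for k
      using e(1) xy(3) c central[OF that x xy(4)] that unfolding f_def by auto
    have "(q \<otimes> h) \<otimes> (q \<otimes> h) = q \<otimes> (h \<otimes> q) \<otimes> h" using q h by (simp add: m_assoc)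
    also have "\<dots> = (q \<otimes> q) \<otimes> (h \<otimes> e) \<otimes> h" unfolding e(2) using q(1) h ef by (simp add: m_assoc)
    also have "\<dots> = f \<otimes> (h \<otimes> h)"
      unfolding f_central(2)[OF h] q(2) f_def using c h ef by (simp add: m_assoc)
    finally have "(q \<otimes> h) [^] (4::nat) = f \<otimes> (h \<otimes> h \<otimes> f) \<otimes> (h \<otimes> h)"
      using q h ef by (simp add: pow_numeral_eq m_assoc)
    also have "h \<otimes> h \<otimes> f = f \<otimes> (h \<otimes> h)" using f_central(1) h by simp
    also have "f \<otimes> (f \<otimes> (h \<otimes> h)) \<otimes> (h \<otimes> h) = (f \<otimes> f) \<otimes> (h \<otimes> h \<otimes> (h \<otimes> h))"
      using ef h by (simp flip: m_assoc)
    finally show ?thesis using ef h qh by (simp add: pow_numeral_eq)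
  qed
  \<comment> \<open>Each of \<open>q\<close> and \<open>h\<close> contributes one \<open>c\<close>
    on passing \<open>r\<close>, and the two cancel.\<close>
  have commute_mult: "(q \<otimes> h) \<otimes> r = r \<otimes> (q \<otimes> h)"
    if h: "h \<in> carrier G" and q: "q \<in> carrier G" and r: "r \<in> carrier G"
      and qr: "q \<otimes> r = r \<otimes> q \<otimes> c" and hr: "h \<otimes> r = r \<otimes> h \<otimes> c" for q h r
  proof -
    have "(q \<otimes> h) \<otimes> r = q \<otimes> (h \<otimes> r)" using q h r by (simp add: m_assoc)
    also have "\<dots> = (q \<otimes> r) \<otimes> (h \<otimes> c)" unfolding hr using q h r c by (simp add: m_assoc)
    also have "\<dots> = r \<otimes> q \<otimes> (c \<otimes> (c \<otimes> h))"
      unfolding qr central[OF h x xy(4)] using q h r c by (simp add: m_assoc)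
    also have "c \<otimes> (c \<otimes> h) = h" using c h xy(3) by (simp flip: m_assoc)
    finally show ?thesis using q h r by (simp add: m_assoc)
  qed
  have commutes_x: "h [^] (4::nat) = \<one>" if h: "h \<in> carrier G" "h \<otimes> x = x \<otimes> h" for h
    using flip[OF h(1) y xy(5)]
  proof
    assume "h \<otimes> y = y \<otimes> h"
    then show ?thesis
      using pow4_if_centralizes_quaternion_pair[OF ham x y c xy h] by blast
  next
    assume hy: "h \<otimes> y = y \<otimes> h \<otimes> c"
    have "(x \<otimes> h) \<otimes> x = x \<otimes> (x \<otimes> h)" using x h by (simp add: m_assoc)
    then have "(x \<otimes> h) [^] (4::nat) = \<one>"
      using commute_mult[OF h(1) x y xy(1) hy] x h
      by (intro pow4_if_centralizes_quaternion_pair[OF ham x y c xy]) simp_all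
    then show ?thesis using pow4_mult[OF h(1) x xy(4)] by blast
  qed
  show ?thesis
    using flip[OF g x xy(4)]
  proof
    assume gx: "g \<otimes> x = x \<otimes> g \<otimes> c"
    have "(y \<otimes> g) [^] (4::nat) = \<one>"
      using commutes_x[of "y \<otimes> g"] commute_mult[OF g y x yx gx] y g by simp
    then show ?thesis using pow4_mult[OF g y xy(5)] by blast
  qed (use commutes_x g in blast)
qed

section \<open>Inversion and affine permutations\<close>

text \<open>The new quotient \<open>x \<otimes> inv y\<close> is the conjugate by \<open>y\<close>
  of the old quotient \<open>inv y \<otimes> x\<close>, hence equal to it or to its inverse by
  exponent four.\<close>

lemma preserves_colors_inv_if_hamiltonian:
  assumes "hamiltonian_two_group G"
  shows "preserves_colors G (\<lambda>x. inv x)"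
  unfolding preserves_colors_def
proof (intro ballI)
  fix x y assume xy: "x \<in> carrier G" "y \<in> carrier G"
  have "inv (inv x) \<otimes> inv y = y \<otimes> (inv y \<otimes> x) \<otimes> inv y"
    using xy by (simp add: m_assoc)
  moreover have "inv (inv y \<otimes> x) = inv x \<otimes> y" using xy by (simp add: inv_mult_group)
  ultimately show "inv (inv x) \<otimes> inv y \<in> {inv x \<otimes> y, inv y \<otimes> x}"
    using conj_eq_self_or_inv[OF assms, of "inv y \<otimes> x" y]
      exponent_four_if_hamiltonian[OF assms, of "inv y \<otimes> x"] xy by auto
qed

text \<open>Evaluation at \<open>\<one>\<close> shows that the translation part is trivial, so
  inversion is a homomorphism.\<close>

lemma comm_group_if_inv_affine:
  assumes "affine_permutation G (\<lambda>x. inv x)"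
  shows "comm_group G"
proof -
  obtain k \<phi> where k: "k \<in> carrier G" and \<phi>: "\<phi> \<in> iso G G"
    and eq: "\<And>x. x \<in> carrier G \<Longrightarrow> inv x = k \<otimes> \<phi> x"
    using assms unfolding affine_permutation_def by blast
  have hom: "\<phi> \<in> hom G G" using \<phi> by (simp add: iso_def)
  have "k = \<one>"
    using eq[of \<one>] hom_one[OF hom is_group is_group] k by simp
  then have inv: "inv x = \<phi> x" if "x \<in> carrier G" for x
    using eq[OF that] hom_in_carrier[OF hom that] by simp
  show ?thesis
  proof (rule group_comm_groupI)
    fix x y assume xy: "x \<in> carrier G" "y \<in> carrier G"
    have "inv (x \<otimes> y) = inv x \<otimes> inv y"
      using hom_mult[OF hom xy] by (simp add: inv xy)
    then have "inv (x \<otimes> y) = inv (y \<otimes> x)"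
      using xy by (simp add: inv_mult_group)
    then show "x \<otimes> y = y \<otimes> x" using xy by (metis inv_inv m_closed)
  qed
qed

lemma affine_if_translate_hom:
  assumes bij: "bij_betw \<alpha> (carrier G) (carrier G)"
    and hom: "(\<lambda>x. inv (\<alpha> \<one>) \<otimes> \<alpha> x) \<in> hom G G"
  shows "affine_permutation G \<alpha>"
proof -
  have \<alpha>: "\<alpha> x \<in> carrier G" if "x \<in> carrier G" for x
    using bij that by (rule bij_betw_apply)
  have "bij_betw (\<lambda>x. inv (\<alpha> \<one>) \<otimes> x) (carrier G) (carrier G)"
    by (rule bij_betw_byWitness[where f' = "\<lambda>x. \<alpha> \<one> \<otimes> x"]) (use \<alpha> in auto)
  then have "bij_betw (\<lambda>x. inv (\<alpha> \<one>) \<otimes> \<alpha> x) (carrier G) (carrier G)"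
    using bij_betw_trans[OF bij] unfolding comp_def by blast
  then have iso: "(\<lambda>x. inv (\<alpha> \<one>) \<otimes> \<alpha> x) \<in> iso G G"
    using hom by (simp add: iso_def)
  show ?thesis
    unfolding affine_permutation_def
    by (rule bexI[OF bexI[OF _ iso] \<alpha>[OF one_closed]]) (simp add: \<alpha>)
qed

end

theorem theorem2p3:
  fixes G :: "('a, 'b) monoid_scheme" (structure)
  assumes "group G" and "finite (carrier G)"
  shows "CCA_graph G (carrier G - {\<one>}) \<longleftrightarrow> \<not> hamiltonian_two_group G"
proof -
  interpret group G by fact
  show ?thesis
  proof
    assume CCA: "CCA_graph G (carrier G - {\<one>})"
    show "\<not> hamiltonian_two_group G"
    proof
      assume ham: "hamiltonian_two_group G"
      have "bij_betw (\<lambda>x. inv x) (carrier G) (carrier G)"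
        by (rule bij_betw_byWitness[where f' = "\<lambda>x. inv x"]) auto
      then have "color_preserving_automorphism G (carrier G - {\<one>}) (\<lambda>x. inv x)"
        using preserves_colors_inv_if_hamiltonian[OF ham]
        by (rule color_preserving_automorphism_complete_iff[THEN iffD2, OF conjI])
      then have "affine_permutation G (\<lambda>x. inv x)"
        by (rule CCA[unfolded CCA_graph_def, rule_format])
      then have "comm_group G" by (rule comm_group_if_inv_affine)
      then show False
        using ham unfolding hamiltonian_two_group_def by simp
    qed
  next
    assume not_ham: "\<not> hamiltonian_two_group G"
    show "CCA_graph G (carrier G - {\<one>})"
      unfolding CCA_graph_def color_preserving_automorphism_complete_iff
    proof (intro allI impI)
      fix \<alpha> assume *: "bij_betw \<alpha> (carrier G) (carrier G) \<and> preserves_colors G \<alpha>"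
      then have \<alpha>: "\<alpha> x \<in> carrier G" if "x \<in> carrier G" for x
        by (rule bij_betw_apply[OF conjunct1]) (rule that)
      \<comment> \<open>Left translation leaves all quotients unchanged, so \<alpha> may be
        normalized to fix \<open>\<one>\<close>.\<close>
      let ?\<beta> = "\<lambda>x. inv (\<alpha> \<one>) \<otimes> \<alpha> x"
      have "inv (?\<beta> x) \<otimes> ?\<beta> y = inv (\<alpha> x) \<otimes> \<alpha> y" if "x \<in> carrier G" "y \<in> carrier G" for x y
        using \<alpha> that by (simp add: inv_mult_group m_assoc)
      then have "preserves_colors G ?\<beta>"
        using * unfolding preserves_colors_def by simp
      moreover have "?\<beta> \<in> carrier G \<rightarrow> carrier G" "?\<beta> \<one> = \<one>"
        using \<alpha> by auto
      ultimately have "?\<beta> \<in> hom G G"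
        using preserves_colors_inv_if_not_hom not_ham hamiltonian_two_group_if_inv_preserves_colors
        by metis
      then show "affine_permutation G \<alpha>"
        by (rule affine_if_translate_hom[OF conjunct1[OF *]])
    qed
  qed
qed

end
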